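(* Let $S$ be a semigroup. Functions $f,g,h:S\to\mathbb{C}$ satisfy $$f(xy)=f(x)g(y)+g(x)f(y)+h(x)h(y),\quad x,y\in S,$$ with $f$ and $h$ linearly dependent, if and only if the triple $(f,g,h)$ has one of the following forms: (1) $f=0$, $g$ is arbitrary and $h=0$. (2) $f=\lambda(\chi_1-\chi_2)$, $g=\frac{\chi_1+\chi_2}{2}-\rho^2\,\frac{\chi_1-\chi_2}{2\lambda}$ and $h=\rho(\chi_1-\chi_2)$, where $\lambda\in\mathbb{C}\setminus\{0\}$ and $\rho\in\mathbb{C}$ are constants and $\chi_1,\chi_2:S\to\mathbb{C}$ are two multiplicative functions with $\chi_1\neq\chi_2$. (3) $f=\varphi$, $g=\chi-\frac{c^2}{2}\varphi$ and $h=c\,\varphi$, where $c\in\mathbb{C}$ is a constant, $\chi:S\to\mathbb{C}$ is a multiplicative function and $\varphi:S\to\mathbb{C}$ is a non-zero function satisfying $\varphi(xy)=\varphi(x)\chi(y)+\chi(x)\varphi(y)$ for all $x,y\in S$.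
   Context: A semigroup is a set with an associative composition. A multiplicative function on $S$ is a function $\chi:S\to\mathbb{C}$ with $\chi(xy)=\chi(x)\chi(y)$ for all $x,y\in S$; the zero function is allowed. A function is non-zero if it is not identically zero. Linear dependence is over $\mathbb{C}$ in the vector space of functions $S\to\mathbb{C}$. *)

theory Defs
  imports Complex_Main
begin

definition multiplicative :: "('a::semigroup_mult \<Rightarrow> complex) \<Rightarrow> bool" where
  "multiplicative \<chi> \<longleftrightarrow> (\<forall>x y. \<chi> (x * y) = \<chi> x * \<chi> y)"

(* Linear dependence over the complex numbers of the pair (f, h), not of the set {f, h}:
   the set-based notion of the library would call {f, f} independent for non-zero f. *)
definition linearly_dependent_pair :: "('a \<Rightarrow> complex) \<Rightarrow> ('a \<Rightarrow> complex) \<Rightarrow> bool" where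
  "linearly_dependent_pair f h \<longleftrightarrow>
    (\<exists>a b. (a, b) \<noteq> (0, 0) \<and> (\<forall>x. a * f x + b * h x = 0))"

end

theory Submission
  imports Defs
begin

text \<open>If \<open>f \<noteq> 0\<close>, dependence gives \<open>h = c f\<close>, and \<open>G = g + (c\<^sup>2 / 2) f\<close> turns the equation into the sine
  addition law \<open>f (x y) = f x G y + G x f y\<close>. Associativity then forces
  \<open>G (x y) = G x G y + d\<^sup>2 f x f y\<close> for some constant \<open>d\<close>, so that \<open>G + d f\<close> and \<open>G - d f\<close> are
  multiplicative. The cases \<open>d \<noteq> 0\<close> and \<open>d = 0\<close> give the forms (2) and (3).\<close>

text \<open>The defect of \<open>G\<close> from being multiplicative turns out to be a constant
  multiple of \<open>f x * f y\<close>. A complex square root \<open>d\<close> of that constant lets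
  the quadratic form factor, which splits the defect into the two combinations with \<open>d\<close>
  and \<open>-d\<close>.\<close>

lemma sine_addition_multiplicative:
  fixes f G :: "'a::semigroup_mult \<Rightarrow> complex"
  assumes sine: "\<And>x y. f (x * y) = f x * G y + G x * f y"
    and nz: "f \<noteq> (\<lambda>x. 0)"
  obtains d where "multiplicative (\<lambda>x. G x + d * f x)" "multiplicative (\<lambda>x. G x - d * f x)"
proof -
  obtain a where a: "f a \<noteq> 0"
    using nz by auto
  define D where "D x y = G (x * y) - G x * G y" for x y
  \<comment> \<open>Expand \<open>f\<close> at a triple product in both bracketings; the term
    \<open>G x * f y * G z\<close> is common and cancels.\<close>
  have swap: "f z * D x y = f x * D y z" for x y z
  proof -
    have "f (x * y) * G z + G (x * y) * f z = f x * G (y * z) + G x * f (y * z)"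
      using sine[of "x * y" z] sine[of x "y * z"] by (simp add: mult.assoc)
    then show ?thesis
      by (simp add: D_def sine algebra_simps)
  qed
  \<comment> \<open>The only possible value: put \<open>x = y = a\<close> in
    \<open>D x y = m * (f x * f y)\<close>.\<close>
  define m where "m = D a a / (f a)\<^sup>2"
  define d where "d = csqrt m"
  have G: "G (x * y) = G x * G y + d\<^sup>2 * (f x * f y)" for x y
  proof -
    \<comment> \<open>Two swaps against \<open>a\<close> move first \<open>x\<close>, then
      \<open>y\<close>, out of \<open>D\<close>, leaving the constant \<open>D a a\<close>.\<close>
    have "(f a)\<^sup>2 * D x y = f x * (f a * D y a)"
      using swap[of a x y] by (simp add: power2_eq_square)
    also have "\<dots> = f x * f y * D a a"
      using swap[of a y a] by simp
    finally have "D x y = m * (f x * f y)"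
      using a by (simp add: m_def field_simps)
    then show ?thesis
      by (simp add: D_def d_def diff_eq_eq add.commute)
  qed
  show thesis
    by (rule that[of d])
      (simp_all add: multiplicative_def sine G algebra_simps power2_eq_square)
qed

theorem theorem4p1:
  fixes f g h :: "'a::semigroup_mult \<Rightarrow> complex"
  shows "((\<forall>x y. f (x * y) = f x * g y + g x * f y + h x * h y) \<and> linearly_dependent_pair f h)
    \<longleftrightarrow>
      (f = (\<lambda>x. 0) \<and> h = (\<lambda>x. 0))
    \<or> (\<exists>l \<rho> \<chi>\<^sub>1 \<chi>\<^sub>2. l \<noteq> 0 \<and> multiplicative \<chi>\<^sub>1 \<and> multiplicative \<chi>\<^sub>2 \<and> \<chi>\<^sub>1 \<noteq> \<chi>\<^sub>2 \<and>
        f = (\<lambda>x. l * (\<chi>\<^sub>1 x - \<chi>\<^sub>2 x)) \<and>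
        g = (\<lambda>x. (\<chi>\<^sub>1 x + \<chi>\<^sub>2 x) / 2 - \<rho>\<^sup>2 * ((\<chi>\<^sub>1 x - \<chi>\<^sub>2 x) / (2 * l))) \<and>
        h = (\<lambda>x. \<rho> * (\<chi>\<^sub>1 x - \<chi>\<^sub>2 x)))
    \<or> (\<exists>c \<chi> \<phi>. multiplicative \<chi> \<and> \<phi> \<noteq> (\<lambda>x. 0) \<and>
        (\<forall>x y. \<phi> (x * y) = \<phi> x * \<chi> y + \<chi> x * \<phi> y) \<and>
        f = \<phi> \<and>
        g = (\<lambda>x. \<chi> x - c\<^sup>2 / 2 * \<phi> x) \<and>
        h = (\<lambda>x. c * \<phi> x))"
    (is "_ \<longleftrightarrow> ?form1 \<or> ?form2 \<or> ?form3")
proof (intro iffI)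
  assume "(\<forall>x y. f (x * y) = f x * g y + g x * f y + h x * h y) \<and> linearly_dependent_pair f h"
  then have eq: "\<And>x y. f (x * y) = f x * g y + g x * f y + h x * h y"
    and dep: "linearly_dependent_pair f h"
    by auto
  show "?form1 \<or> ?form2 \<or> ?form3"
  proof (cases "f = (\<lambda>x. 0)")
    case True
    then have "h x * h x = 0" for x
      using eq[of x x] by simp
    then show ?thesis
      using True by auto
  next
    case False
    from dep obtain a b where ab: "(a, b) \<noteq> (0, 0)" "\<And>x. a * f x + b * h x = 0"
      unfolding linearly_dependent_pair_def by blast
    \<comment> \<open>Otherwise \<open>a\<close> is non-zero and \<open>a * f x = 0\<close> for all
      \<open>x\<close>, so \<open>f\<close> vanishes.\<close>
    have "b \<noteq> 0"
      using ab False by auto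
    define c where "c = - a / b"
    have h: "h x = c * f x" for x
      using ab(2)[of x] \<open>b \<noteq> 0\<close> by (simp add: c_def field_simps add_eq_0_iff)
    \<comment> \<open>Since \<open>h x * h y\<close> equals \<open>c\<^sup>2 * f x * f y\<close>,
      each of the two mixed products absorbs half of it.\<close>
    define G where "G x = g x + c\<^sup>2 / 2 * f x" for x
    have sine: "f (x * y) = f x * G y + G x * f y" for x y
      using eq[of x y] by (simp add: G_def h power2_eq_square field_simps)
    obtain d where mult: "multiplicative (\<lambda>x. G x + d * f x)" "multiplicative (\<lambda>x. G x - d * f x)"
      using sine_addition_multiplicative[OF sine False] by blast
    show ?thesis
    proof (cases "d = 0")
      case True
      \<comment> \<open>For \<open>d = 0\<close> both multiplicative functions are \<open>G\<close>
        itself, so \<chi> is \<open>G\<close> and \<phi> is \<open>f\<close>.\<close>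
      have "?form3"
      proof (intro exI conjI)
        show "g = (\<lambda>x. G x - c\<^sup>2 / 2 * f x)"
          by (simp add: G_def)
        show "h = (\<lambda>x. c * f x)"
          using h by auto
      qed (use mult(1) sine False True in auto)
      then show ?thesis by blast
    next
      case d: False
      \<comment> \<open>The multiplicative functions \<open>G x + d * f x\<close> and
        \<open>G x - d * f x\<close> have half-sum \<open>G x\<close> and difference
        \<open>2 * d * f x\<close>. This dictates \<open>l = 1 / (2 * d)\<close> and \<rho>
        \<open>= c / (2 * d)\<close>.\<close>
      have "?form2"
      proof (intro exI conjI)
        show "1 / (2 * d) \<noteq> 0"
          using d by simp
        show "(\<lambda>x. G x + d * f x) \<noteq> (\<lambda>x. G x - d * f x)"
        proof
          assume "(\<lambda>x. G x + d * f x) = (\<lambda>x. G x - d * f x)"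
          then have "G x + d * f x = G x - d * f x" for x
            by (rule fun_cong)
          then have "f x = 0" for x
            using d by (simp add: eq_diff_eq)
          then show False
            using False by auto
        qed
        show "f = (\<lambda>x. 1 / (2 * d) * (G x + d * f x - (G x - d * f x)))"
          using d by auto
        show "g = (\<lambda>x. (G x + d * f x + (G x - d * f x)) / 2
            - (c / (2 * d))\<^sup>2 * ((G x + d * f x - (G x - d * f x)) / (2 * (1 / (2 * d)))))"
          using d by (auto simp: G_def field_simps power2_eq_square)
        show "h = (\<lambda>x. c / (2 * d) * (G x + d * f x - (G x - d * f x)))"
          using d h by auto
      qed (use mult in auto)
      then show ?thesis by blast
    qed
  qed
next
  assume "?form1 \<or> ?form2 \<or> ?form3"
  then consider ?form1 | ?form2 | ?form3 by blast
  then show "(\<forall>x y. f (x * y) = f x * g y + g x * f y + h x * h y) \<and> linearly_dependent_pair f h"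
  proof cases
    case 1
    then show ?thesis
      by (auto simp: linearly_dependent_pair_def intro: exI[of _ 1])
  next
    case 2
    then obtain l \<rho> \<chi>\<^sub>1 \<chi>\<^sub>2 where l: "l \<noteq> 0"
      and mult: "multiplicative \<chi>\<^sub>1" "multiplicative \<chi>\<^sub>2"
      and f: "f = (\<lambda>x. l * (\<chi>\<^sub>1 x - \<chi>\<^sub>2 x))"
      and g: "g = (\<lambda>x. (\<chi>\<^sub>1 x + \<chi>\<^sub>2 x) / 2 - \<rho>\<^sup>2 * ((\<chi>\<^sub>1 x - \<chi>\<^sub>2 x) / (2 * l)))"
      and h: "h = (\<lambda>x. \<rho> * (\<chi>\<^sub>1 x - \<chi>\<^sub>2 x))"
      by blast
    \<comment> \<open>The correction in \<open>g\<close> enters through both mixed products and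
      cancels \<open>h x * h y\<close>; the rest is a difference of products.\<close>
    have "f (x * y) = f x * g y + g x * f y + h x * h y" for x y
      using l mult by (simp add: f g h multiplicative_def field_simps power2_eq_square)
    moreover have "linearly_dependent_pair f h"
      unfolding linearly_dependent_pair_def
      by (rule exI[of _ \<rho>], rule exI[of _ "- l"]) (simp add: f h l)
    ultimately show ?thesis by blast
  next
    case 3
    then obtain c \<chi> where "\<forall>x y. f (x * y) = f x * \<chi> y + \<chi> x * f y"
      and g: "g = (\<lambda>x. \<chi> x - c\<^sup>2 / 2 * f x)" and h: "h = (\<lambda>x. c * f x)"
      by blast
    then have "f (x * y) = f x * g y + g x * f y + h x * h y" for x y
      by (simp add: g h field_simps power2_eq_square)
    \<comment> \<open>The coefficient of \<open>h\<close> is \<open>-1\<close>, so the pair of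
      coefficients is non-zero even when \<open>c = 0\<close>.\<close>
    moreover have "linearly_dependent_pair f h"
      unfolding linearly_dependent_pair_def
      by (rule exI[of _ c], rule exI[of _ "- 1"]) (simp add: h)
    ultimately show ?thesis by blast
  qed
qed

end
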